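(* Let $\mathcal M$ be a matroid of rank $d$ on the ground set $[n]$ and let $\mathcal M^{\triangle}$ be a matroid of rank $n-d$ on the ground set $\mathcal C(\mathcal M)$. The following are equivalent: (1) $\mathcal M^{\triangle}$ is an adjoint of $\mathcal M$; (2) $I((\mathcal L^* )^{opp})\subseteq I(\mathcal M^{\triangle})\subseteq \mathcal S(\mathcal M)$; (3) for every $i\in[n]$ that is not a co-loop of $\mathcal M$, the set $\{C\in\mathcal C(\mathcal M): i\notin C\}$ is a hyperplane of $\mathcal M^{\triangle}$.
   Context: $\mathcal C(\mathcal M)$ is the set of circuits of $\mathcal M$, $E=[n]$, $\mathcal M^*$ is the dual matroid (rank $n-d$), a co-loop of $\mathcal M$ is a loop of $\mathcal M^*$, and $I(\mathcal N)$ denotes the family of independent sets of a matroid $\mathcal N$. $\mathcal L^*$ is the lattice of flats of $\mathcal M^*$ and $(\mathcal L^* )^{opp}$ its order dual; it is a finite bounded atomic graded lattice with rank function $\mathrm{rank}_{opp}(F)=(n-d)-r_{\mathcal M^*}(F)$, whose atoms are the hyperplanes of $\mathcal M^*$, i.e. the sets $E\setminus C$ for $C\in\mathcal C(\mathcal M)$; we identify the atom $E\setminus C$ with the circuit $C$. For a finite bounded lattice $\mathcal L$ and a linear order $\omega$ on its set of atoms, a nonempty set $D$ of atoms is bounded below if some atom $a$ is strictly $\omega$-smaller than every $d\in D$ and $a\le\bigvee D$; a set of atoms is NBB for $\omega$ if it has no bounded below subset; $I(\mathcal L)$ is the family of sets of atoms that are NBB for some linear order. Via the identification above, $I((\mathcal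 L^* )^{opp})$ is a family of subsets of $\mathcal C(\mathcal M)$. Define $\mathcal S(\mathcal M)=\{\mathcal S\subseteq\mathcal C(\mathcal M): |\mathcal S|\le (n-d)-r_{\mathcal M^*}(\bigcap_{C\in\mathcal S}(E\setminus C))\}$ (empty intersection $=E$). A matroid $\mathcal N$ on ground set $\mathcal C(\mathcal M)$ with lattice of flats $\mathcal L(\mathcal N)$ is an adjoint of $\mathcal M$ if the map sending the atom $E\setminus C$ of $(\mathcal L^* )^{opp}$ to the closure $\mathrm{cl}_{\mathcal N}(\{C\})$ is a bijection onto the atoms of $\mathcal L(\mathcal N)$ and extends to a rank-preserving order embedding $f:(\mathcal L^* )^{opp}\to\mathcal L(\mathcal N)$ (i.e. $x\le y\iff f(x)\le f(y)$ and ranks are preserved). *)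

theory Defs
  imports "HOL-Algebra.Lattice"
begin

section \<open>Matroids\<close>

record 'a matroid =
  ground :: "'a set"
  indeps :: "'a set set"

locale matroid =
  fixes M :: "'a matroid"
  assumes finite_ground: "finite (ground M)"
    and indeps_subset: "X \<in> indeps M \<Longrightarrow> X \<subseteq> ground M"
    and empty_indep: "{} \<in> indeps M"
    and indeps_down: "\<lbrakk>X \<in> indeps M; Y \<subseteq> X\<rbrakk> \<Longrightarrow> Y \<in> indeps M"
    and augment: "\<lbrakk>X \<in> indeps M; Y \<in> indeps M; card X < card Y\<rbrakk> \<Longrightarrow> \<exists>y\<in>Y - X. insert y X \<in> indeps M"

definition matroid_rank :: "'a matroid \<Rightarrow> 'a set \<Rightarrow> nat"
  where "matroid_rank M X = Max (card ` {Y \<in> indeps M. Y \<subseteq> X})"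

definition matroid_bases :: "'a matroid \<Rightarrow> 'a set set"
  where "matroid_bases M = {B \<in> indeps M. \<forall>X\<in>indeps M. B \<subseteq> X \<longrightarrow> X = B}"

definition circuits :: "'a matroid \<Rightarrow> 'a set set"
  where "circuits M = {C. C \<subseteq> ground M \<and> C \<notin> indeps M \<and> (\<forall>X. X \<subset> C \<longrightarrow> X \<in> indeps M)}"

definition dual_matroid :: "'a matroid \<Rightarrow> 'a matroid"
  where "dual_matroid M =
    \<lparr> ground = ground M,
      indeps = {X. X \<subseteq> ground M \<and> (\<exists>B\<in>matroid_bases M. X \<inter> B = {})} \<rparr>"

definition loops :: "'a matroid \<Rightarrow> 'a set"
  where "loops M = {e \<in> ground M. {e} \<notin> indeps M}"

definition coloops :: "'a matroid \<Rightarrow> 'a set"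
  where "coloops M = loops (dual_matroid M)"

definition matroid_closure :: "'a matroid \<Rightarrow> 'a set \<Rightarrow> 'a set"
  where "matroid_closure M X = {e \<in> ground M. matroid_rank M (insert e X) = matroid_rank M X}"

definition flats :: "'a matroid \<Rightarrow> 'a set set"
  where "flats M = {F. F \<subseteq> ground M \<and> matroid_closure M F = F}"

text \<open>The hyperplanes are the flats of corank 1; with \<^const>\<open>Suc\<close> instead of truncated
  subtraction, a matroid of rank 0 has none.\<close>

definition hyperplanes :: "'a matroid \<Rightarrow> 'a set set"
  where "hyperplanes M = {H \<in> flats M. Suc (matroid_rank M H) = matroid_rank M (ground M)}"

definition flat_lattice :: "'a matroid \<Rightarrow> 'a set gorder"
  where "flat_lattice M = \<lparr> carrier = flats M, eq = (=), le = (\<subseteq>) \<rparr>"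


section \<open>NBB sets in lattices\<close>

definition lattice_atoms :: "'a gorder \<Rightarrow> 'a set"
  where "lattice_atoms L =
    {a \<in> carrier L. \<bottom>\<^bsub>L\<^esub> \<sqsubset>\<^bsub>L\<^esub> a \<and> (\<forall>x\<in>carrier L. x \<sqsubset>\<^bsub>L\<^esub> a \<longrightarrow> x = \<bottom>\<^bsub>L\<^esub>)}"

text \<open>Linear orders \<open>\<omega>\<close> on the atoms are reflexive, as in \<^const>\<open>linear_order_on\<close>.\<close>

definition bounded_below :: "'a gorder \<Rightarrow> 'a rel \<Rightarrow> 'a set \<Rightarrow> bool"
  where "bounded_below L \<omega> D \<longleftrightarrow>
    D \<noteq> {} \<and> D \<subseteq> lattice_atoms L \<and>
    (\<exists>a\<in>lattice_atoms L. (\<forall>d\<in>D. (a, d) \<in> \<omega> \<and> a \<noteq> d) \<and> a \<sqsubseteq>\<^bsub>L\<^esub> \<Squnion>\<^bsub>L\<^esub>D)"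

definition NBB :: "'a gorder \<Rightarrow> 'a rel \<Rightarrow> 'a set \<Rightarrow> bool"
  where "NBB L \<omega> A \<longleftrightarrow> A \<subseteq> lattice_atoms L \<and> \<not> (\<exists>D\<subseteq>A. bounded_below L \<omega> D)"

definition NBB_family :: "'a gorder \<Rightarrow> 'a set set"
  where "NBB_family L = {A. \<exists>\<omega>. linear_order_on (lattice_atoms L) \<omega> \<and> NBB L \<omega> A}"


section \<open>Adjoints\<close>

text \<open>The order dual of the lattice of flats of the dual matroid. Its atoms are the hyperplanes
  of the dual matroid, that is, the complements of the circuits of \<open>M\<close>.\<close>

definition opp_lattice :: "'a matroid \<Rightarrow> 'a set gorder"
  where "opp_lattice M = inv_gorder (flat_lattice (dual_matroid M))"

text \<open>The subtractions are not truncated: \<open>card (ground M) - matroid_rank M (ground M)\<close> is the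
  rank of the dual matroid.\<close>

definition opp_rank :: "'a matroid \<Rightarrow> 'a set \<Rightarrow> nat"
  where "opp_rank M F =
    (card (ground M) - matroid_rank M (ground M)) - matroid_rank (dual_matroid M) F"

text \<open>The family of NBB sets of \<^term>\<open>opp_lattice M\<close>, transported to sets of circuits along
  the identification of a circuit \<open>C\<close> with the atom \<open>ground M - C\<close>.\<close>

definition opp_NBB_family :: "'a matroid \<Rightarrow> 'a set set set"
  where "opp_NBB_family M =
    {S. S \<subseteq> circuits M \<and> (\<lambda>C. ground M - C) ` S \<in> NBB_family (opp_lattice M)}"

text \<open>The leading \<open>ground M \<inter>\<close> makes the empty intersection equal to the ground set.\<close>

definition S_family :: "'a matroid \<Rightarrow> 'a set set set"
  where "S_family M =
    {S. S \<subseteq> circuits M \<and> card S \<le> opp_rank M (ground M \<inter> (\<Inter>C\<in>S. ground M - C))}"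

text \<open>Since \<open>H = ground M - C\<close> is equivalent to \<open>C = ground M - H\<close> for subsets of the ground set,
  the map on atoms \<open>ground M - C \<mapsto> cl(C)\<close> is written as a function of \<open>H\<close>.\<close>

definition adjoint :: "'a matroid \<Rightarrow> 'a set matroid \<Rightarrow> bool"
  where "adjoint M N \<longleftrightarrow>
    matroid N \<and> ground N = circuits M \<and>
    bij_betw (\<lambda>H. matroid_closure N {ground M - H})
      (lattice_atoms (opp_lattice M)) (lattice_atoms (flat_lattice N)) \<and>
    (\<exists>f \<in> carrier (opp_lattice M) \<rightarrow> carrier (flat_lattice N).
      (\<forall>H\<in>lattice_atoms (opp_lattice M). f H = matroid_closure N {ground M - H}) \<and>
      order_emb (opp_lattice M) (flat_lattice N) f \<and>
      (\<forall>F\<in>carrier (opp_lattice M). matroid_rank N (f F) = opp_rank M F))"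

end

theory Submission
  imports Defs
begin

text \<open>Write \<open>av F\<close> for the set of circuits disjoint from a flat \<open>F\<close> of the dual matroid. Since the
  atom of a circuit \<open>C\<close> lies below \<open>F\<close> in the opposite lattice iff \<open>C\<close> is disjoint from \<open>F\<close>, the
  only candidate for the embedding of an adjoint is \<open>F \<mapsto> av F\<close>, so \<open>N\<close> is an adjoint iff every
  \<open>av F\<close> is a flat of \<open>N\<close> of the right rank.

  From this (3) is the case of the closure of a point, and \<open>indeps N \<subseteq> S_family M\<close> is the rank
  condition. If an NBB set contained a circuit of \<open>N\<close>, its smallest element would lie below the
  join of the others, bounding them from below.

  Conversely, under (3) every \<open>av F\<close> is an intersection of hyperplanes; as \<open>av\<close> is strictly
  antitone and both lattices have the same height, ranks must agree. Under (2), the set \<open>av {i}\<close>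
  has no independent set of full size because of \<open>S_family M\<close>, while together with any circuit
  through \<open>i\<close> it contains an NBB set of full size, so it is a hyperplane.\<close>

section \<open>Rank and closure\<close>

context matroid
begin

lemma finite_indep: "X \<in> indeps M \<Longrightarrow> finite X"
  using finite_ground indeps_subset finite_subset by blast

lemma finite_indeps: "finite (indeps M)"
  by (rule finite_subset[of _ "Pow (ground M)"]) (use finite_ground indeps_subset in auto)

lemma card_le_rank:
  assumes "Y \<in> indeps M" "Y \<subseteq> X"
  shows "card Y \<le> matroid_rank M X"
  unfolding matroid_rank_def using assms finite_indeps by (intro Max_ge) auto

lemma obtain_basis:
  obtains Y where "Y \<in> indeps M" "Y \<subseteq> X" "card Y = matroid_rank M X"
proof -
  have "Max (card ` {Y \<in> indeps M. Y \<subseteq> X}) \<in> card ` {Y \<in> indeps M. Y \<subseteq> X}"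
    using finite_indeps empty_indep by (intro Max_in) auto
  with that show thesis
    unfolding matroid_rank_def by auto
qed

text \<open>A largest independent set between \<open>I\<close> and \<open>X\<close> works: if it
  were smaller than a basis of \<open>X\<close>, augmenting from that basis would enlarge it inside
  \<open>X\<close>.\<close>

lemma extend_to_basis:
  assumes "I \<in> indeps M" "I \<subseteq> X"
  obtains Y where "Y \<in> indeps M" "I \<subseteq> Y" "Y \<subseteq> X" "card Y = matroid_rank M X"
proof -
  let ?F = "{Y \<in> indeps M. I \<subseteq> Y \<and> Y \<subseteq> X}"
  have "finite ?F" "?F \<noteq> {}"
    using finite_indeps assms by auto
  then obtain Y where Y: "Y \<in> ?F" and max: "\<And>Z. Z \<in> ?F \<Longrightarrow> card Z \<le> card Y"
    using obtains_MAX[of ?F card] by (metis (no_types, lifting) Max_ge finite_imageI image_eqI)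
  obtain Z where Z: "Z \<in> indeps M" "Z \<subseteq> X" "card Z = matroid_rank M X"
    by (rule obtain_basis)
  have "\<not> card Y < card Z"
  proof
    assume "card Y < card Z"
    then obtain z where z: "z \<in> Z - Y" "insert z Y \<in> indeps M"
      using augment Y Z(1) by blast
    then have "insert z Y \<in> ?F"
      using Y Z by auto
    then show False
      using max z Y finite_indep[of Y] by fastforce
  qed
  then have "card Y = matroid_rank M X"
    using Z card_le_rank[of Y X] Y by auto
  with Y show thesis
    using that by auto
qed

lemma rank_mono: "X \<subseteq> Y \<Longrightarrow> matroid_rank M X \<le> matroid_rank M Y"
  by (metis obtain_basis card_le_rank order_trans)

lemma rank_indep:
  assumes "X \<in> indeps M"
  shows "matroid_rank M X = card X"
  using assms finite_indep[OF assms] card_le_rank[OF assms order_refl]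
  by (metis obtain_basis card_mono order_antisym)

lemma rank_insert_le: "matroid_rank M (insert e X) \<le> Suc (matroid_rank M X)"
proof -
  obtain Y where Y: "Y \<in> indeps M" "Y \<subseteq> insert e X" "card Y = matroid_rank M (insert e X)"
    by (rule obtain_basis)
  have "card (Y - {e}) \<le> matroid_rank M X"
    using Y indeps_down[of Y "Y - {e}"] by (intro card_le_rank) auto
  moreover have "card Y \<le> Suc (card (Y - {e}))"
    by (cases "e \<in> Y") (use card_Suc_Diff1 finite_indep[OF Y(1)] in force)+
  ultimately show ?thesis
    using Y by simp
qed

lemma indep_iff_rank:
  assumes "X \<subseteq> ground M"
  shows "X \<in> indeps M \<longleftrightarrow> matroid_rank M X = card X"
proof
  assume "matroid_rank M X = card X"
  then obtain Y where "Y \<in> indeps M" "Y \<subseteq> X" "card Y = card X"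
    using obtain_basis by metis
  then show "X \<in> indeps M"
    using card_subset_eq[of X Y] assms finite_ground finite_subset by metis
qed (rule rank_indep)

text \<open>Otherwise a basis \<open>B\<close> of \<open>X\<close> could be augmented by some
  \<open>y\<close> from a larger independent subset of \<open>X \<union> Y\<close>, and this
  \<open>y\<close> would raise the rank of \<open>X\<close>.\<close>

lemma rank_Un_eq:
  assumes "\<And>e. e \<in> Y \<Longrightarrow> matroid_rank M (insert e X) = matroid_rank M X"
  shows "matroid_rank M (X \<union> Y) = matroid_rank M X"
proof (rule ccontr)
  assume ne: "matroid_rank M (X \<union> Y) \<noteq> matroid_rank M X"
  obtain B where B: "B \<in> indeps M" "B \<subseteq> X" "card B = matroid_rank M X"
    by (rule obtain_basis)
  obtain B' where B': "B' \<in> indeps M" "B' \<subseteq> X \<union> Y" "card B' = matroid_rank M (X \<union> Y)"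
    by (rule obtain_basis)
  have "card B < card B'"
    using ne B B' rank_mono[of X "X \<union> Y"] by auto
  then obtain y where y: "y \<in> B' - B" "insert y B \<in> indeps M"
    using augment B B' by blast
  then have "Suc (card B) \<le> matroid_rank M (insert y X)"
    using card_le_rank[of "insert y B" "insert y X"] B finite_indep[of B] by auto
  moreover have "matroid_rank M (insert y X) = matroid_rank M X"
    using y B' assms by (cases "y \<in> X") (auto simp: insert_absorb)
  ultimately show False
    using B by simp
qed

text \<open>Local form of submodularity. Extend a basis \<open>B\<close> of \<open>X\<close> to a
  basis \<open>B'\<close> of \<open>Y\<close>. If \<open>e\<close> raised the rank of
  \<open>Y\<close>, then \<open>B'\<close> could be augmented, necessarily by \<open>e\<close>;
  hence \<open>insert e B\<close> would be independent and \<open>e\<close> would already raise the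
  rank of \<open>X\<close>.\<close>

lemma rank_insert_eq_mono:
  assumes "matroid_rank M (insert e X) = matroid_rank M X" "X \<subseteq> Y"
  shows "matroid_rank M (insert e Y) = matroid_rank M Y"
proof (rule ccontr)
  assume ne: "matroid_rank M (insert e Y) \<noteq> matroid_rank M Y"
  obtain B where B: "B \<in> indeps M" "B \<subseteq> X" "card B = matroid_rank M X"
    by (rule obtain_basis)
  obtain B' where B': "B' \<in> indeps M" "B \<subseteq> B'" "B' \<subseteq> Y" "card B' = matroid_rank M Y"
    using extend_to_basis[of B Y] B assms by blast
  obtain B'' where B'': "B'' \<in> indeps M" "B'' \<subseteq> insert e Y" "card B'' = matroid_rank M (insert e Y)"
    by (rule obtain_basis)
  have "card B' < card B''"
    using ne B' B'' rank_mono[OF subset_insertI, of Y e] by auto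
  then obtain z where z: "z \<in> B'' - B'" "insert z B' \<in> indeps M"
    using augment B' B'' by blast
  have "z \<notin> Y"
  proof
    assume "z \<in> Y"
    then have "card (insert z B') \<le> matroid_rank M Y"
      using z B' by (intro card_le_rank) auto
    then show False
      using z B' finite_indep[of B'] by auto
  qed
  then have "z = e" "z \<notin> B"
    using z B'' B' by auto
  moreover have "insert z B \<in> indeps M"
    using indeps_down[OF z(2)] B' by blast
  ultimately have "Suc (card B) \<le> matroid_rank M (insert e X)"
    using card_le_rank[of "insert z B" "insert e X"] B finite_indep[of B] by auto
  then show False
    using assms B by simp
qed

section \<open>Closure, flats and hyperplanes\<close>

lemma closure_subset_ground: "matroid_closure M X \<subseteq> ground M"
  by (auto simp: matroid_closure_def)

lemma subset_closure: "X \<subseteq> ground M \<Longrightarrow> X \<subseteq> matroid_closure M X"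
  by (auto simp: matroid_closure_def insert_absorb)

lemma closure_mono: "X \<subseteq> Y \<Longrightarrow> matroid_closure M X \<subseteq> matroid_closure M Y"
  using rank_insert_eq_mono by (auto simp: matroid_closure_def)

lemma rank_closure:
  assumes "X \<subseteq> ground M"
  shows "matroid_rank M (matroid_closure M X) = matroid_rank M X"
proof -
  have "X \<union> matroid_closure M X = matroid_closure M X"
    using subset_closure[OF assms] by auto
  then show ?thesis
    using rank_Un_eq[of "matroid_closure M X" X] by (auto simp: matroid_closure_def)
qed

text \<open>An \<open>e\<close> in the closure of the closure leaves the rank of the closure fixed,
  and that rank is the rank of \<open>X\<close>; by monotonicity \<open>e\<close> cannot raise the
  rank of \<open>X\<close> either.\<close>

lemma closure_flat:
  assumes "X \<subseteq> ground M"
  shows "matroid_closure M X \<in> flats M"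
proof -
  have "e \<in> matroid_closure M X" if e: "e \<in> matroid_closure M (matroid_closure M X)" for e
  proof -
    have "matroid_rank M (insert e X) \<le> matroid_rank M (insert e (matroid_closure M X))"
      using subset_closure[OF assms] by (intro rank_mono) auto
    then show ?thesis
      using e rank_closure[OF assms] rank_mono[OF subset_insertI, of X e]
      by (auto simp: matroid_closure_def)
  qed
  then have "matroid_closure M (matroid_closure M X) = matroid_closure M X"
    using subset_closure[OF closure_subset_ground] by blast
  then show ?thesis
    using closure_subset_ground by (simp add: flats_def)
qed

lemma closure_subset_flat: "F \<in> flats M \<Longrightarrow> X \<subseteq> F \<Longrightarrow> matroid_closure M X \<subseteq> F"
  using closure_mono[of X F] by (simp add: flats_def)

lemma closure_subset_flat_iff:
  "F \<in> flats M \<Longrightarrow> X \<subseteq> ground M \<Longrightarrow> matroid_closure M X \<subseteq> F \<longleftrightarrow> X \<subseteq> F"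
  using closure_subset_flat subset_closure by blast

lemma flatI:
  assumes "F \<subseteq> ground M" "\<And>e. e \<in> ground M - F \<Longrightarrow> matroid_rank M (insert e F) \<noteq> matroid_rank M F"
  shows "F \<in> flats M"
  using assms subset_closure[of F] by (auto simp: flats_def matroid_closure_def)

lemma flat_subset: "F \<in> flats M \<Longrightarrow> F \<subseteq> ground M"
  by (auto simp: flats_def)

lemma ground_flat: "ground M \<in> flats M"
  by (rule flatI) auto

lemma Inter_flat:
  assumes "\<F> \<subseteq> flats M"
  shows "ground M \<inter> \<Inter>\<F> \<in> flats M"
proof -
  have "matroid_closure M (ground M \<inter> \<Inter>\<F>) \<subseteq> ground M \<inter> \<Inter>\<F>"
  proof (intro Int_greatest Inter_greatest)
    fix F
    assume "F \<in> \<F>"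
    then show "matroid_closure M (ground M \<inter> \<Inter>\<F>) \<subseteq> F"
      using assms by (intro closure_subset_flat) auto
  qed (rule closure_subset_ground)
  then show ?thesis
    using subset_closure[of "ground M \<inter> \<Inter>\<F>"] by (simp add: flats_def subset_antisym)
qed

lemma flat_insert_rank:
  assumes "F \<in> flats M" "e \<in> ground M - F"
  shows "matroid_rank M (insert e F) = Suc (matroid_rank M F)"
proof -
  have "matroid_rank M (insert e F) \<noteq> matroid_rank M F"
    using assms by (auto simp: flats_def matroid_closure_def)
  then show ?thesis
    using rank_mono[OF subset_insertI, of F e] rank_insert_le[of e F] by auto
qed

lemma flat_rank_strict:
  assumes "F \<in> flats M" "F \<subset> X" "X \<subseteq> ground M"
  shows "matroid_rank M F < matroid_rank M X"
proof -
  obtain e where e: "e \<in> X - F"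
    using assms by auto
  then have "Suc (matroid_rank M F) \<le> matroid_rank M X"
    using flat_insert_rank[of F e] assms rank_mono[of "insert e F" X] by auto
  then show ?thesis
    by simp
qed

lemma flat_cover_above:
  assumes "F \<in> flats M" "F \<noteq> ground M"
  obtains G where "G \<in> flats M" "F \<subset> G" "matroid_rank M G = Suc (matroid_rank M F)"
proof -
  obtain e where e: "e \<in> ground M - F"
    using assms flat_subset by blast
  then have sub: "insert e F \<subseteq> ground M"
    using assms flat_subset by auto
  show thesis
    using that[of "matroid_closure M (insert e F)"] closure_flat[OF sub] subset_closure[OF sub]
      rank_closure[OF sub] flat_insert_rank[OF assms(1) e] e by auto
qed

text \<open>Dropping one element from a basis of \<open>F\<close> and closing up loses exactly one
  rank.\<close>

lemma flat_cover_below: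
  assumes "F \<in> flats M" "0 < matroid_rank M F"
  obtains G where "G \<in> flats M" "G \<subset> F" "Suc (matroid_rank M G) = matroid_rank M F"
proof -
  obtain B where B: "B \<in> indeps M" "B \<subseteq> F" "card B = matroid_rank M F"
    by (rule obtain_basis)
  then obtain b where b: "b \<in> B"
    using assms by (metis card.empty equals0I less_irrefl)
  let ?G = "matroid_closure M (B - {b})"
  have ind: "B - {b} \<in> indeps M"
    using B indeps_down by blast
  then have r: "Suc (matroid_rank M ?G) = matroid_rank M F"
    using B b rank_closure[OF indeps_subset[OF ind]] rank_indep[OF ind] finite_indep[OF B(1)] 
    by (metis card_Suc_Diff1)
  moreover have "?G \<subseteq> F"
    using closure_subset_flat[OF assms(1)] B by blast
  ultimately have "?G \<subset> F"
    by auto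
  then show thesis
    using that r closure_flat indeps_subset[OF ind] by blast
qed

text \<open>This form suits complementation, which exchanges maximal nonspanning sets with minimal
  dependent sets of the dual. Conversely, one further element takes \<open>H\<close> to full rank,
  and a single element raises the rank by at most 1, so the corank is 1.\<close>

lemma hyperplane_iff_maximal_nonspanning:
  "H \<in> hyperplanes M \<longleftrightarrow> H \<subseteq> ground M \<and> matroid_rank M H \<noteq> matroid_rank M (ground M) \<and>
    (\<forall>X\<subseteq>ground M. H \<subset> X \<longrightarrow> matroid_rank M X = matroid_rank M (ground M))"
  (is "_ \<longleftrightarrow> ?R")
proof
  assume "H \<in> hyperplanes M"
  then have H: "H \<in> flats M" "Suc (matroid_rank M H) = matroid_rank M (ground M)"
    by (auto simp: hyperplanes_def)
  show ?R
  proof (intro conjI allI impI)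
    fix X
    assume X: "X \<subseteq> ground M" "H \<subset> X"
    show "matroid_rank M X = matroid_rank M (ground M)"
      using flat_rank_strict[OF H(1) X(2,1)] rank_mono[OF X(1)] H(2) by linarith
  qed (use H flat_subset in auto)
next
  assume R: ?R
  have ne: "H \<subseteq> ground M" "matroid_rank M H \<noteq> matroid_rank M (ground M)"
    using R by metis+
  have ins: "matroid_rank M (insert e H) = matroid_rank M (ground M)" if "e \<in> ground M - H" for e
    using R[THEN conjunct2, THEN conjunct2, rule_format, of "insert e H"] ne(1) that by auto
  have flat: "H \<in> flats M"
    using ne ins by (intro flatI) auto
  have "H \<noteq> ground M"
    using ne(2) by auto
  with ne(1) obtain e where e: "e \<in> ground M - H"
    by blast
  show "H \<in> hyperplanes M"
    using flat flat_insert_rank[OF flat e] ins[OF e] by (simp add: hyperplanes_def)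
qed

text \<open>The form that matches atoms of the opposite lattice. It reduces to maximal nonspanning
  sets because the closure of a set strictly above \<open>H\<close> is a flat strictly above
  \<open>H\<close>.\<close>

lemma hyperplane_iff_maximal_flat:
  "H \<in> hyperplanes M \<longleftrightarrow> H \<in> flats M \<and> H \<noteq> ground M \<and> (\<forall>F\<in>flats M. H \<subset> F \<longrightarrow> F = ground M)"
  (is "_ \<longleftrightarrow> ?R")
proof
  assume "H \<in> hyperplanes M"
  then have H: "H \<in> flats M" "Suc (matroid_rank M H) = matroid_rank M (ground M)"
    by (auto simp: hyperplanes_def)
  have "F = ground M" if F: "F \<in> flats M" "H \<subset> F" for F
  proof (rule ccontr)
    assume "F \<noteq> ground M"
    then have "matroid_rank M F < matroid_rank M (ground M)"
      using flat_rank_strict[OF F(1)] flat_subset[OF F(1)] by blast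
    moreover have "matroid_rank M H < matroid_rank M F"
      using flat_rank_strict[OF H(1) F(2)] flat_subset[OF F(1)] by blast
    ultimately show False
      using H(2) by linarith
  qed
  moreover have "H \<noteq> ground M"
    using H(2) by auto
  ultimately show ?R
    using H(1) by blast
next
  assume R: ?R
  have spanning: "matroid_rank M X = matroid_rank M (ground M)" if X: "X \<subseteq> ground M" "H \<subset> X" for X
  proof -
    have "H \<subset> matroid_closure M X"
      using subset_closure[OF X(1)] X(2) by auto
    then have "matroid_closure M X = ground M"
      using R closure_flat[OF X(1)] by blast
    then show ?thesis
      using rank_closure[OF X(1)] by simp
  qed
  have "matroid_rank M H \<noteq> matroid_rank M (ground M)"
  proof -
    have "H \<in> flats M" "H \<subset> ground M"
      using R flat_subset[of H] by blast+
    from flat_rank_strict[OF this] show ?thesis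
      by simp
  qed
  moreover have "\<forall>X\<subseteq>ground M. H \<subset> X \<longrightarrow> matroid_rank M X = matroid_rank M (ground M)"
    by (intro allI impI) (rule spanning)
  moreover have "H \<subseteq> ground M"
    using R flat_subset by blast
  ultimately show "H \<in> hyperplanes M"
    unfolding hyperplane_iff_maximal_nonspanning by (intro conjI)
qed

section \<open>Bases, circuits and separation by hyperplanes\<close>

lemma bases_eq: "matroid_bases M = {B \<in> indeps M. card B = matroid_rank M (ground M)}"
proof -
  have "(\<forall>X\<in>indeps M. B \<subseteq> X \<longrightarrow> X = B) \<longleftrightarrow> card B = matroid_rank M (ground M)"
    if B: "B \<in> indeps M" for B
  proof
    assume max: "\<forall>X\<in>indeps M. B \<subseteq> X \<longrightarrow> X = B"
    obtain Y where Y: "Y \<in> indeps M" "B \<subseteq> Y" "card Y = matroid_rank M (ground M)"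
      by (rule extend_to_basis[OF B indeps_subset[OF B]])
    with max[rule_format, OF Y(1,2)] show "card B = matroid_rank M (ground M)"
      by simp
  next
    assume r: "card B = matroid_rank M (ground M)"
    show "\<forall>X\<in>indeps M. B \<subseteq> X \<longrightarrow> X = B"
    proof (intro ballI impI)
      fix X
      assume X: "X \<in> indeps M" "B \<subseteq> X"
      show "X = B"
        using card_seteq[OF finite_indep[OF X(1)] X(2)]
          card_le_rank[OF X(1) indeps_subset[OF X(1)]] r by simp
    qed
  qed
  then show ?thesis
    unfolding matroid_bases_def by (intro Collect_cong conj_cong refl)
qed

lemma obtain_circuit:
  assumes "X \<subseteq> ground M" "X \<notin> indeps M"
  obtains C where "C \<in> circuits M" "C \<subseteq> X"
proof -
  have "finite X"
    using assms finite_ground finite_subset by blast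
  then have "\<exists>C\<subseteq>X. C \<notin> indeps M \<and> (\<forall>Y. Y \<subset> C \<longrightarrow> Y \<in> indeps M)"
    using assms(2)
  proof (induction X rule: finite_psubset_induct)
    case (psubset X)
    show ?case
    proof (cases "\<forall>Y. Y \<subset> X \<longrightarrow> Y \<in> indeps M")
      case False
      then show ?thesis
        using psubset by (metis dual_order.trans psubset_imp_subset)
    qed (use psubset in auto)
  qed
  then show thesis
    using that assms by (auto simp: circuits_def)
qed

text \<open>The rank of \<open>C\<close> lies between \<open>card C - 1\<close>, the rank of the
  independent set \<open>C - {c}\<close>, and \<open>card C\<close>, which dependence
  excludes.\<close>

lemma circuit_closure:
  assumes "C \<in> circuits M" "c \<in> C"
  shows "c \<in> matroid_closure M (C - {c})"
proof -
  have C: "C \<subseteq> ground M" "C \<notin> indeps M" "C - {c} \<in> indeps M"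
    using assms by (auto simp: circuits_def)
  have "matroid_rank M C \<noteq> card C"
    using C indep_iff_rank by blast
  moreover have "matroid_rank M C \<le> Suc (matroid_rank M (C - {c}))"
    using rank_insert_le[of c "C - {c}"] assms by (simp add: insert_absorb)
  moreover have "Suc (matroid_rank M (C - {c})) = card C"
    using rank_indep[OF C(3)] assms C(1) finite_ground
    by (metis card_Suc_Diff1 finite_subset)
  moreover have "matroid_rank M (C - {c}) \<le> matroid_rank M C"
    by (rule rank_mono) auto
  ultimately show ?thesis
    using assms C by (auto simp: matroid_closure_def insert_absorb)
qed

lemma basis_minus_hyperplane:
  assumes B: "B \<in> indeps M" "card B = matroid_rank M (ground M)" and b: "b \<in> B"
  shows "matroid_closure M (B - {b}) \<in> hyperplanes M" "b \<notin> matroid_closure M (B - {b})"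
proof -
  have ind: "B - {b} \<in> indeps M"
    using B indeps_down by blast
  have r: "Suc (matroid_rank M (B - {b})) = card B"
    using b rank_indep[OF ind] finite_indep[OF B(1)] by (metis card_Suc_Diff1)
  show "matroid_closure M (B - {b}) \<in> hyperplanes M"
    using r B(2) closure_flat[OF indeps_subset[OF ind]] rank_closure[OF indeps_subset[OF ind]]
    by (simp add: hyperplanes_def)
  show "b \<notin> matroid_closure M (B - {b})"
    using r b rank_indep[OF B(1)] by (auto simp: matroid_closure_def insert_absorb)
qed

text \<open>Every flat is thus an intersection of hyperplanes. Extend a basis \<open>I\<close> of
  \<open>F\<close> to a basis \<open>B\<close> of the matroid through \<open>e\<close>; then
  \<open>B - {e}\<close> still spans \<open>F\<close>, and its closure is a hyperplane missing
  \<open>e\<close>.\<close>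

lemma flat_separation:
  assumes F: "F \<in> flats M" and e: "e \<in> ground M - F"
  obtains H where "H \<in> hyperplanes M" "F \<subseteq> H" "e \<notin> H"
proof -
  obtain I where I: "I \<in> indeps M" "I \<subseteq> F" "card I = matroid_rank M F"
    by (rule obtain_basis)
  have "F \<subseteq> matroid_closure M I"
  proof
    fix x
    assume x: "x \<in> F"
    have "matroid_rank M (insert x I) \<le> matroid_rank M F"
      using x I(2) by (intro rank_mono) auto
    then show "x \<in> matroid_closure M I"
      using x flat_subset[OF F] I(3) rank_indep[OF I(1)] rank_mono[OF subset_insertI, of I x]
      by (auto simp: matroid_closure_def)
  qed
  obtain J where J: "J \<in> indeps M" "J \<subseteq> insert e F" "I \<subseteq> J" "card J = matroid_rank M (insert e F)"
    by (rule extend_to_basis[OF I(1) subset_insertI2[OF I(2)]])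
  \<comment> \<open>A \<open>J\<close> inside \<open>F\<close> would be an independent subset of
    \<open>F\<close> larger than its rank.\<close>
  have "e \<in> J"
  proof (rule ccontr)
    assume "e \<notin> J"
    then have "card J \<le> matroid_rank M F"
      using J by (intro card_le_rank) auto
    then show False
      using J(4) flat_insert_rank[OF F e] by simp
  qed
  obtain B where B: "B \<in> indeps M" "J \<subseteq> B" "B \<subseteq> ground M" "card B = matroid_rank M (ground M)"
    by (rule extend_to_basis[OF J(1) indeps_subset[OF J(1)]])
  have "e \<in> B" "I \<subseteq> B - {e}"
    using \<open>e \<in> J\<close> B(2) J(3) I(2) e by auto
  then show thesis
    using that basis_minus_hyperplane[OF B(1,4)] \<open>F \<subseteq> matroid_closure M I\<close>
      closure_mono[of I "B - {e}"] by blast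
qed

lemma loop_in_flat:
  assumes F: "F \<in> flats M" and e: "e \<in> loops M"
  shows "e \<in> F"
proof -
  have "matroid_rank M {e} = 0"
  proof -
    obtain Y where Y: "Y \<in> indeps M" "Y \<subseteq> {e}" "card Y = matroid_rank M {e}"
      by (rule obtain_basis)
    then have "Y = {}"
      using e by (auto simp: loops_def subset_singleton_iff)
    with Y show ?thesis
      by simp
  qed
  then have "e \<in> matroid_closure M {}"
    using e rank_mono[of "{}" "{e}"] by (simp add: matroid_closure_def loops_def)
  then show ?thesis
    using closure_subset_flat[OF F, of "{}"] by blast
qed

text \<open>\<open>bottom\<close> is a Hilbert choice, so the closure of the empty set must be shown
  to be the only least element.\<close>

lemma bottom_flat_lattice: "\<bottom>\<^bsub>flat_lattice M\<^esub> = matroid_closure M {}"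
  unfolding bottom_def
proof (rule some_equality)
  show "least (flat_lattice M) (matroid_closure M {}) (carrier (flat_lattice M))"
    using closure_flat closure_subset_flat by (simp add: least_def flat_lattice_def)
  then show "x = matroid_closure M {}" if "least (flat_lattice M) x (carrier (flat_lattice M))" for x
    using that by (simp add: least_def flat_lattice_def subset_antisym)
qed

section \<open>Duality\<close>

lemma ground_dual [simp]: "ground (dual_matroid M) = ground M"
  by (simp add: dual_matroid_def)

lemma indep_dual_iff:
  "X \<in> indeps (dual_matroid M) \<longleftrightarrow>
    X \<subseteq> ground M \<and> matroid_rank M (ground M - X) = matroid_rank M (ground M)"
proof -
  have "matroid_rank M (ground M - X) = matroid_rank M (ground M) \<longleftrightarrow>
      (\<exists>B\<in>matroid_bases M. X \<inter> B = {})"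
  proof
    assume r: "matroid_rank M (ground M - X) = matroid_rank M (ground M)"
    obtain B where "B \<in> indeps M" "B \<subseteq> ground M - X" "card B = matroid_rank M (ground M - X)"
      by (rule obtain_basis)
    with r have "B \<in> matroid_bases M" "X \<inter> B = {}"
      by (auto simp: bases_eq)
    then show "\<exists>B\<in>matroid_bases M. X \<inter> B = {}"
      by blast
  next
    assume "\<exists>B\<in>matroid_bases M. X \<inter> B = {}"
    then obtain B where B: "B \<in> indeps M" "card B = matroid_rank M (ground M)" "X \<inter> B = {}"
      by (auto simp: bases_eq)
    then have "card B \<le> matroid_rank M (ground M - X)"
      using indeps_subset[of B] by (intro card_le_rank) auto
    then show "matroid_rank M (ground M - X) = matroid_rank M (ground M)"
      using B rank_mono[of "ground M - X" "ground M"] by auto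
  qed
  then show ?thesis
    by (auto simp: dual_matroid_def)
qed

text \<open>Only augmentation needs work. Let \<open>B\<close> be a basis avoiding \<open>X\<close>
  that contains a basis \<open>I\<close> of the complement of \<open>X \<union> Y\<close>. If
  augmentation fails, \<open>B\<close> contains all of \<open>Y - X\<close>, so |I| + |Y - X| \<le>
  |B|. A basis \<open>J\<close> avoiding \<open>Y\<close> has at most |I| elements outside
  \<open>X\<close> and the others in \<open>X - Y\<close>, so |B| \<le> |I| + |X - Y|. Together
  these contradict |X| < |Y|.\<close>

lemma matroid_dual: "matroid (dual_matroid M)"
proof
  show "finite (ground (dual_matroid M))" "{} \<in> indeps (dual_matroid M)"
    using finite_ground by (auto simp: indep_dual_iff)
next
  fix X Y
  assume X: "X \<in> indeps (dual_matroid M)"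
  then show "X \<subseteq> ground (dual_matroid M)"
    by (simp add: indep_dual_iff)
  assume "Y \<subseteq> X"
  then have "matroid_rank M (ground M - X) \<le> matroid_rank M (ground M - Y)"
    by (intro rank_mono) auto
  then show "Y \<in> indeps (dual_matroid M)"
    using X \<open>Y \<subseteq> X\<close> rank_mono[of "ground M - Y" "ground M"] by (auto simp: indep_dual_iff)
next
  fix X Y
  assume X: "X \<in> indeps (dual_matroid M)" and Y: "Y \<in> indeps (dual_matroid M)"
    and less: "card X < card Y"
  let ?E = "ground M"
  have fin: "finite X" "finite Y"
    using X Y finite_ground finite_subset by (auto simp: indep_dual_iff)
  show "\<exists>y\<in>Y - X. insert y X \<in> indeps (dual_matroid M)"
  proof (rule ccontr)
    assume no: "\<not> ?thesis"
    obtain I where I: "I \<in> indeps M" "I \<subseteq> ?E - (X \<union> Y)" "card I = matroid_rank M (?E - (X \<union> Y))"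
      by (rule obtain_basis)
    obtain B where B: "B \<in> indeps M" "I \<subseteq> B" "B \<subseteq> ?E - X" "card B = matroid_rank M (?E - X)"
      using extend_to_basis[of I "?E - X"] I by blast
    have rB: "card B = matroid_rank M ?E"
      using B X by (simp add: indep_dual_iff)
    have "y \<in> B" if y: "y \<in> Y - X" for y
    proof (rule ccontr)
      assume "y \<notin> B"
      then have "card B \<le> matroid_rank M (?E - insert y X)"
        using B by (intro card_le_rank) auto
      then have "insert y X \<in> indeps (dual_matroid M)"
        using rB X Y y rank_mono[of "?E - insert y X" ?E] by (auto simp: indep_dual_iff)
      then show False
        using no y by blast
    qed
    then have "I \<union> (Y - X) \<subseteq> B" "I \<inter> (Y - X) = {}"
      using B I by auto
    then have "card I + card (Y - X) \<le> card B"
      using card_mono[of B "I \<union> (Y - X)"] card_Un_disjoint[of I "Y - X"] finite_indep[OF B(1)]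
        finite_indep[OF I(1)] fin by auto
    moreover have "card B \<le> card I + card (X - Y)"
    proof -
      obtain J where J: "J \<in> indeps M" "J \<subseteq> ?E - Y" "card J = matroid_rank M (?E - Y)"
        by (rule obtain_basis)
      have "J - X \<in> indeps M" "J - X \<subseteq> ?E - (X \<union> Y)"
        using J indeps_down[of J "J - X"] by auto
      then have "card (J - X) \<le> card I"
        using I card_le_rank by metis
      moreover have "card J \<le> card (J - X) + card (X - Y)"
        using card_mono[of "(J - X) \<union> (X - Y)" J] card_Un_le[of "J - X" "X - Y"]
          finite_indep[OF J(1)] fin J(2) by fastforce
      ultimately show ?thesis
        using J rB Y by (simp add: indep_dual_iff)
    qed
    ultimately have "card (Y - X) \<le> card (X - Y)"
      by simp
    then show False
      using less card_Int_Diff[OF fin(1), of Y] card_Int_Diff[OF fin(2), of X]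
      by (simp add: Int_commute)
  qed
qed

lemma rank_dual_ground:
  "matroid_rank (dual_matroid M) (ground M) = card (ground M) - matroid_rank M (ground M)"
proof -
  interpret D: matroid "dual_matroid M"
    by (rule matroid_dual)
  obtain B where B: "B \<in> indeps M" "B \<subseteq> ground M" "card B = matroid_rank M (ground M)"
    by (rule obtain_basis)
  then have "ground M - B \<in> indeps (dual_matroid M)"
    by (simp add: indep_dual_iff double_diff rank_indep)
  then have "card (ground M - B) \<le> matroid_rank (dual_matroid M) (ground M)"
    by (rule D.card_le_rank) auto
  moreover
  obtain X where X: "X \<in> indeps (dual_matroid M)" "X \<subseteq> ground M"
      "card X = matroid_rank (dual_matroid M) (ground M)"
    by (rule D.obtain_basis)
  obtain B' where B': "B' \<in> indeps M" "B' \<subseteq> ground M - X" "card B' = matroid_rank M (ground M - X)"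
    by (rule obtain_basis)
  have "matroid_rank M (ground M) \<le> card (ground M - X)"
    using B' X finite_ground by (metis card_mono finite_Diff indep_dual_iff)
  moreover have "card X \<le> card (ground M)" "card B \<le> card (ground M)"
    by (rule card_mono[OF finite_ground X(2)], rule card_mono[OF finite_ground B(2)])
  ultimately show ?thesis
    using X B finite_ground by (simp add: card_Diff_subset finite_subset)
qed

text \<open>\<open>indep_dual_iff\<close> with the two matroids exchanged, obtained by complementing
  bases: \<open>X\<close> extends to a basis whose complement has full size in the dual, and the
  complement of a dual basis disjoint from \<open>X\<close> is a basis containing
  \<open>X\<close>.\<close>

lemma indep_iff_compl_spanning_dual:
  assumes "X \<subseteq> ground M"
  shows "X \<in> indeps M \<longleftrightarrow>
    matroid_rank (dual_matroid M) (ground M - X) = matroid_rank (dual_matroid M) (ground M)"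
proof -
  interpret D: matroid "dual_matroid M"
    by (rule matroid_dual)
  show ?thesis
  proof
    assume "X \<in> indeps M"
    then obtain B where B: "B \<in> indeps M" "X \<subseteq> B" "B \<subseteq> ground M" "card B = matroid_rank M (ground M)"
      using extend_to_basis[of X "ground M"] assms by blast
    then have "ground M - B \<in> indeps (dual_matroid M)"
      by (simp add: indep_dual_iff double_diff rank_indep)
    then have "card (ground M - B) \<le> matroid_rank (dual_matroid M) (ground M - X)"
      using B by (intro D.card_le_rank) auto
    then show "matroid_rank (dual_matroid M) (ground M - X) = matroid_rank (dual_matroid M) (ground M)"
      using B D.rank_mono[of "ground M - X" "ground M"] finite_ground
      by (simp add: rank_dual_ground card_Diff_subset finite_subset)
  next
    assume r: "matroid_rank (dual_matroid M) (ground M - X) = matroid_rank (dual_matroid M) (ground M)"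
    obtain Y where Y: "Y \<in> indeps (dual_matroid M)" "Y \<subseteq> ground M - X"
      "card Y = matroid_rank (dual_matroid M) (ground M - X)"
      by (rule D.obtain_basis)
    have "card (ground M - Y) = matroid_rank M (ground M)"
    proof -
      have "matroid_rank M (ground M) \<le> card (ground M)"
        by (metis obtain_basis card_mono finite_ground)
      moreover have "card (ground M - Y) = card (ground M) - card Y"
        using Y finite_ground by (metis D.indeps_subset card_Diff_subset finite_subset ground_dual)
      ultimately show ?thesis
        using Y r by (simp add: rank_dual_ground)
    qed
    then have "ground M - Y \<in> indeps M"
      using Y by (simp add: indep_iff_rank indep_dual_iff)
    then show "X \<in> indeps M"
      using Y assms by (auto intro: indeps_down)
  qed
qed

text \<open>Complementation turns dependent sets into nonspanning sets of the dual and reverses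
  inclusion, so minimal dependent becomes maximal nonspanning.\<close>

lemma circuit_iff_hyperplane_dual:
  assumes "C \<subseteq> ground M"
  shows "C \<in> circuits M \<longleftrightarrow> ground M - C \<in> hyperplanes (dual_matroid M)"
proof -
  interpret D: matroid "dual_matroid M"
    by (rule matroid_dual)
  let ?sp = "\<lambda>X. matroid_rank (dual_matroid M) X = matroid_rank (dual_matroid M) (ground M)"
  have proper: "(\<forall>X. X \<subset> C \<longrightarrow> X \<in> indeps M) \<longleftrightarrow> (\<forall>X\<subseteq>ground M. ground M - C \<subset> X \<longrightarrow> ?sp X)"
  proof (intro iffI allI impI)
    fix X
    assume "\<forall>X. X \<subset> C \<longrightarrow> X \<in> indeps M" "X \<subseteq> ground M" "ground M - C \<subset> X"
    moreover from this have "ground M - X \<subset> C"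
      by blast
    ultimately show "?sp X"
      using indep_iff_compl_spanning_dual[of "ground M - X"] by (simp add: double_diff)
  next
    fix X
    assume "\<forall>X\<subseteq>ground M. ground M - C \<subset> X \<longrightarrow> ?sp X" "X \<subset> C"
    moreover from this assms have "ground M - C \<subset> ground M - X" "X \<subseteq> ground M"
      by blast+
    ultimately show "X \<in> indeps M"
      using indep_iff_compl_spanning_dual[of X] by simp
  qed
  have dep: "C \<notin> indeps M \<longleftrightarrow> \<not> ?sp (ground M - C)"
    using indep_iff_compl_spanning_dual[OF assms] by simp
  have circuit: "C \<in> circuits M \<longleftrightarrow> C \<notin> indeps M \<and> (\<forall>X. X \<subset> C \<longrightarrow> X \<in> indeps M)"
    unfolding circuits_def mem_Collect_eq by (simp only: assms simp_thms)
  have hyperplane: "ground M - C \<in> hyperplanes (dual_matroid M) \<longleftrightarrow> \<not> ?sp (ground M - C) \<and>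
      (\<forall>X\<subseteq>ground M. ground M - C \<subset> X \<longrightarrow> ?sp X)"
    unfolding D.hyperplane_iff_maximal_nonspanning ground_dual
    by (simp only: Diff_subset simp_thms)
  show ?thesis
    unfolding circuit hyperplane proper dep ..
qed

lemma hyperplanes_dual: "hyperplanes (dual_matroid M) = (\<lambda>C. ground M - C) ` circuits M"
proof -
  have "H \<in> (\<lambda>C. ground M - C) ` circuits M" if "H \<in> hyperplanes (dual_matroid M)" for H
  proof
    have "H \<subseteq> ground M"
      using that by (auto simp: hyperplanes_def flats_def)
    then show "H = ground M - (ground M - H)" "ground M - H \<in> circuits M"
      using that by (auto simp: circuit_iff_hyperplane_dual double_diff)
  qed
  moreover have "ground M - C \<in> hyperplanes (dual_matroid M)" if "C \<in> circuits M" for C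
  proof -
    have "C \<subseteq> ground M"
      using that by (simp add: circuits_def)
    with that show ?thesis
      by (simp add: circuit_iff_hyperplane_dual)
  qed
  ultimately show ?thesis
    by blast
qed

section \<open>The order dual of the lattice of flats of the dual matroid\<close>

lemma opp_lattice_simps [simp]:
  "carrier (opp_lattice M) = flats (dual_matroid M)"
  "F \<sqsubseteq>\<^bsub>opp_lattice M\<^esub> G \<longleftrightarrow> G \<subseteq> F"
  "F \<sqsubset>\<^bsub>opp_lattice M\<^esub> G \<longleftrightarrow> G \<subset> F"
  by (auto simp: opp_lattice_def flat_lattice_def lless_def)

lemma lattice_atoms_opp: "lattice_atoms (opp_lattice M) = hyperplanes (dual_matroid M)"
proof -
  interpret D: matroid "dual_matroid M"
    by (rule matroid_dual)
  have "\<bottom>\<^bsub>opp_lattice M\<^esub> = ground M"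
    unfolding bottom_def
  proof (rule some_equality)
    show "least (opp_lattice M) (ground M) (carrier (opp_lattice M))"
      using D.ground_flat D.flat_subset by (simp add: least_def)
    then show "x = ground M" if "least (opp_lattice M) x (carrier (opp_lattice M))" for x
      using that by (simp add: least_def subset_antisym)
  qed
  then have "F \<in> lattice_atoms (opp_lattice M) \<longleftrightarrow> F \<in> hyperplanes (dual_matroid M)" for F
    unfolding lattice_atoms_def D.hyperplane_iff_maximal_flat
    using D.flat_subset[of F] by (auto simp: psubset_eq)
  then show ?thesis
    by blast
qed

text \<open>Joins for reversed inclusion are intersections; \<open>ground M\<close> takes care of
  the empty family, whose join is the bottom of the opposite lattice.\<close>

lemma Sup_opp:
  assumes "\<F> \<subseteq> flats (dual_matroid M)"
  shows "\<Squnion>\<^bsub>opp_lattice M\<^esub>\<F> = ground M \<inter> \<Inter>\<F>"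
  unfolding Lattice.sup_def
proof (rule some_equality)
  interpret D: matroid "dual_matroid M"
    by (rule matroid_dual)
  have "ground M \<inter> \<Inter>\<F> \<in> flats (dual_matroid M)"
    using D.Inter_flat[OF assms] by simp
  then show lub: "least (opp_lattice M) (ground M \<inter> \<Inter>\<F>) (Upper (opp_lattice M) \<F>)"
    using assms D.flat_subset by (auto simp: least_def Upper_def)
  show "x = ground M \<inter> \<Inter>\<F>" if "least (opp_lattice M) x (Upper (opp_lattice M) \<F>)" for x
    using that lub by (meson least_def opp_lattice_simps(2) subset_antisym)
qed

end

lemma weak_partial_order_flat_lattice: "weak_partial_order (flat_lattice M)"
  by unfold_locales (auto simp: flat_lattice_def)

lemma weak_partial_order_opp_lattice: "weak_partial_order (opp_lattice M)"
  by unfold_locales (auto simp: opp_lattice_def flat_lattice_def)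

text \<open>This is \<open>av\<close> of the overview. It is defined for arbitrary sets, not only
  flats, so that it also applies to a single point \<open>{i}\<close>.\<close>

definition avoiding :: "'a matroid \<Rightarrow> 'a set \<Rightarrow> 'a set set"
  where "avoiding M F = {C \<in> circuits M. C \<inter> F = {}}"

lemma avoiding_antimono: "F \<subseteq> G \<Longrightarrow> avoiding M G \<subseteq> avoiding M F"
  by (auto simp: avoiding_def)

text \<open>The standing hypotheses on \<open>M\<close> and \<open>N\<close>; by
  \<open>rank_dual_ground\<close>, the rank condition says that \<open>N\<close> has the rank of the
  dual of \<open>M\<close>.\<close>

locale adjoint_candidate = matroid M + N: matroid N
  for M :: "'a matroid" and N :: "'a set matroid" +
  assumes ground_N: "ground N = circuits M"
    and rank_N: "matroid_rank N (ground N) = card (ground M) - matroid_rank M (ground M)"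
begin

sublocale D: matroid "dual_matroid M"
  by (rule matroid_dual)

lemma rank_N_eq: "matroid_rank N (circuits M) = matroid_rank (dual_matroid M) (ground M)"
  using rank_N by (simp add: ground_N rank_dual_ground)

lemma opp_rank_eq:
  "opp_rank M F = matroid_rank (dual_matroid M) (ground M) - matroid_rank (dual_matroid M) F"
  by (simp add: opp_rank_def rank_dual_ground)

lemma circuit_subset: "C \<in> circuits M \<Longrightarrow> C \<subseteq> ground M"
  by (simp add: circuits_def)

lemma circuit_nonempty: "C \<in> circuits M \<Longrightarrow> C \<noteq> {}"
  using empty_indep by (auto simp only: circuits_def)

lemma circuit_compl_hyperplane: "C \<in> circuits M \<Longrightarrow> ground M - C \<in> hyperplanes (dual_matroid M)"
  by (simp add: hyperplanes_dual)

lemma circuit_compl_flat: "C \<in> circuits M \<Longrightarrow> ground M - C \<in> flats (dual_matroid M)"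
  using circuit_compl_hyperplane by (simp add: hyperplanes_def)

text \<open>Being disjoint from \<open>C\<close> means lying in the flat
  \<open>ground M - C\<close>, and a flat contains a set iff it contains its closure.\<close>

lemma avoiding_closure:
  assumes "X \<subseteq> ground M"
  shows "avoiding M (matroid_closure (dual_matroid M) X) = avoiding M X"
proof -
  have "C \<inter> matroid_closure (dual_matroid M) X = {} \<longleftrightarrow> C \<inter> X = {}" if "C \<in> circuits M" for C
    using D.closure_subset_flat_iff[OF circuit_compl_flat[OF that], of X] assms
      D.closure_subset_ground[of X] by auto
  then show ?thesis
    unfolding avoiding_def by blast
qed

text \<open>This makes \<open>avoiding\<close> an order embedding. If \<open>e\<close> is in
  \<open>G\<close> but not in \<open>F\<close>, a hyperplane through \<open>F\<close> missing
  \<open>e\<close> is the complement of a circuit that avoids \<open>F\<close> and meets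
  \<open>G\<close> in \<open>e\<close>.\<close>

lemma avoiding_subset_iff:
  assumes F: "F \<in> flats (dual_matroid M)" and G: "G \<subseteq> ground M"
  shows "avoiding M F \<subseteq> avoiding M G \<longleftrightarrow> G \<subseteq> F"
proof
  assume sub: "avoiding M F \<subseteq> avoiding M G"
  show "G \<subseteq> F"
  proof (rule ccontr)
    assume "\<not> G \<subseteq> F"
    then obtain e where e: "e \<in> G" "e \<in> ground (dual_matroid M) - F"
      using G by auto
    obtain H where H: "H \<in> hyperplanes (dual_matroid M)" "F \<subseteq> H" "e \<notin> H"
      by (rule D.flat_separation[OF F e(2)])
    then obtain C where C: "C \<in> circuits M" "H = ground M - C"
      by (auto simp: hyperplanes_dual)
    then have "C \<in> avoiding M F"
      using H circuit_subset by (auto simp: avoiding_def)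
    moreover have "C \<notin> avoiding M G"
      using C H e by (auto simp: avoiding_def)
    ultimately show False
      using sub by blast
  qed
qed (rule avoiding_antimono)

text \<open>A circuit disjoint from \<open>ground M - C\<close> lies inside \<open>C\<close>, and no
  circuit properly contains another.\<close>

lemma avoiding_hyperplane:
  assumes "C \<in> circuits M"
  shows "avoiding M (ground M - C) = {C}"
proof -
  have "C' = C" if "C' \<in> circuits M" "C' \<inter> (ground M - C) = {}" for C'
  proof (rule ccontr)
    assume "C' \<noteq> C"
    then have "C' \<subset> C"
      using that circuit_subset[of C'] by blast
    with assms that(1) show False
      by (simp add: circuits_def)
  qed
  with assms show ?thesis
    unfolding avoiding_def by blast
qed

text \<open>The lattice embedding underlying an adjoint is determined by its values on the atoms: it
  sends \<open>F\<close> to the set of circuits whose atom lies below \<open>F\<close> in the opposite order.\<close>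

lemma adjoint_iff_avoiding:
  "adjoint M N \<longleftrightarrow> (\<forall>F\<in>flats (dual_matroid M).
    avoiding M F \<in> flats N \<and> matroid_rank N (avoiding M F) = opp_rank M F)"
proof
  assume "adjoint M N"
  then obtain f where
    f: "f \<in> flats (dual_matroid M) \<rightarrow> flats N"
      "\<And>C. C \<in> circuits M \<Longrightarrow> f (ground M - C) = matroid_closure N {C}"
      "\<And>F G. F \<in> flats (dual_matroid M) \<Longrightarrow> G \<in> flats (dual_matroid M) \<Longrightarrow> f F \<subseteq> f G \<longleftrightarrow> G \<subseteq> F"
      "\<And>F. F \<in> flats (dual_matroid M) \<Longrightarrow> matroid_rank N (f F) = opp_rank M F"
    unfolding adjoint_def order_emb_def
    by (auto simp: flat_lattice_def lattice_atoms_opp hyperplanes_dual double_diff circuit_subset)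
  have "f F = avoiding M F" if F: "F \<in> flats (dual_matroid M)" for F
  proof -
    \<comment> \<open>Membership in the flat \<open>f F\<close> is the order relation between the
      image of the atom of \<open>C\<close> and \<open>f F\<close>, which the embedding
      reflects.\<close>
    have "C \<in> f F \<longleftrightarrow> C \<inter> F = {}" if C: "C \<in> circuits M" for C
    proof -
      have "C \<in> f F \<longleftrightarrow> f (ground M - C) \<subseteq> f F"
        using N.closure_subset_flat_iff[of "f F" "{C}"] f(1,2) F C ground_N by auto
      also have "\<dots> \<longleftrightarrow> F \<subseteq> ground M - C"
        by (rule f(3)[OF circuit_compl_flat[OF C] F])
      also have "\<dots> \<longleftrightarrow> C \<inter> F = {}"
        using D.flat_subset[OF F] by auto
      finally show ?thesis .
    qed
    moreover have "f F \<subseteq> circuits M"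
      using f(1) F N.flat_subset ground_N by blast
    ultimately show ?thesis
      by (auto simp: avoiding_def)
  qed
  then show "\<forall>F\<in>flats (dual_matroid M).
      avoiding M F \<in> flats N \<and> matroid_rank N (avoiding M F) = opp_rank M F"
    using f(1,4) by (metis PiE)
next
  assume av: "\<forall>F\<in>flats (dual_matroid M).
    avoiding M F \<in> flats N \<and> matroid_rank N (avoiding M F) = opp_rank M F"
  \<comment> \<open>By the two values \<open>avoiding M (ground M - C) = {C}\<close> and
    \<open>avoiding M (ground M) = {}\<close>, the matroid \<open>N\<close> is simple; its atoms are
    the singletons and the map on atoms becomes complementation.\<close>
  have singleton: "{C} \<in> flats N" if "C \<in> circuits M" for C
    using av circuit_compl_flat[OF that] avoiding_hyperplane[OF that] by force
  have cl: "matroid_closure N {C} = {C}" if "C \<in> circuits M" for C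
    using singleton[OF that] by (simp add: flats_def)
  have empty: "{} \<in> flats N"
  proof -
    have "avoiding M (ground M) = {}"
      using circuit_subset circuit_nonempty unfolding avoiding_def by blast
    then show ?thesis
      using av D.ground_flat by force
  qed
  then have bot: "\<bottom>\<^bsub>flat_lattice N\<^esub> = {}"
    by (simp add: N.bottom_flat_lattice flats_def)
  have atoms: "lattice_atoms (flat_lattice N) = (\<lambda>C. {C}) ` circuits M"
  proof
    show "(\<lambda>C. {C}) ` circuits M \<subseteq> lattice_atoms (flat_lattice N)"
      using singleton bot by (auto simp: lattice_atoms_def flat_lattice_def lless_def)
    show "lattice_atoms (flat_lattice N) \<subseteq> (\<lambda>C. {C}) ` circuits M"
    proof
      fix A
      assume A: "A \<in> lattice_atoms (flat_lattice N)"
      then have "A \<in> flats N" "A \<noteq> {}"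
        using bot by (auto simp: lattice_atoms_def flat_lattice_def lless_def)
      then obtain C where C: "C \<in> A" "C \<in> circuits M"
        using N.flat_subset ground_N by blast
      then have "A = {C}"
        using A singleton[of C] bot by (auto simp: lattice_atoms_def flat_lattice_def lless_def)
      with C show "A \<in> (\<lambda>C. {C}) ` circuits M"
        by blast
    qed
  qed
  have "bij_betw (\<lambda>H. matroid_closure N {ground M - H})
      (lattice_atoms (opp_lattice M)) (lattice_atoms (flat_lattice N))"
    unfolding lattice_atoms_opp atoms hyperplanes_dual bij_betw_def
    using cl circuit_subset by (auto simp: inj_on_def double_diff image_image)
  moreover have "avoiding M \<in> flats (dual_matroid M) \<rightarrow> flats N"
    using av by blast
  moreover have "\<forall>H\<in>lattice_atoms (opp_lattice M). avoiding M H = matroid_closure N {ground M - H}"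
    using cl circuit_subset by (auto simp: lattice_atoms_opp hyperplanes_dual avoiding_hyperplane double_diff)
  moreover have "order_emb (opp_lattice M) (flat_lattice N) (avoiding M)"
    using weak_partial_order_flat_lattice weak_partial_order_opp_lattice avoiding_subset_iff D.flat_subset
    by (auto simp: order_emb_def flat_lattice_def)
  ultimately show "adjoint M N"
    unfolding adjoint_def using av ground_N N.matroid_axioms
    by (auto simp: flat_lattice_def intro!: bexI[of _ "avoiding M"])
qed

end

section \<open>The equivalence\<close>

lemma finite_linear_order_min:
  assumes "linear_order_on A \<omega>" "finite X" "X \<noteq> {}" "X \<subseteq> A"
  shows "\<exists>x\<in>X. \<forall>y\<in>X. (x, y) \<in> \<omega>"
  using assms(2-4)
proof (induction X rule: finite_ne_induct)
  case (singleton x)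
  then show ?case
    using assms(1) by (auto simp: order_on_defs refl_on_def)
next
  case (insert z F)
  then obtain x where x: "x \<in> F" "\<forall>y\<in>F. (x, y) \<in> \<omega>"
    by auto
  have tr: "trans \<omega>" and tot: "total_on A \<omega>" and re: "(z, z) \<in> \<omega>"
    using assms(1) insert.prems by (auto simp: order_on_defs refl_on_def)
  have "x \<in> A" "z \<in> A" "x \<noteq> z"
    using x(1) insert.prems insert.hyps by auto
  with tot consider "(x, z) \<in> \<omega>" | "(z, x) \<in> \<omega>"
    by (auto simp: total_on_def)
  then show ?case
  proof cases
    case 1
    with x show ?thesis
      by auto
  next
    case 2
    then have "\<forall>y\<in>F. (z, y) \<in> \<omega>"
      using x(2) tr by (meson transD)
    with re show ?thesis
      by auto
  qed
qed

text \<open>Sort by \<open>key\<close> and break ties by an injection into the naturals, which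
  restores antisymmetry.\<close>

lemma linear_order_on_of_key:
  fixes key :: "'a \<Rightarrow> nat"
  assumes "finite A"
  obtains \<omega> where "linear_order_on A \<omega>" "\<And>a b. (a, b) \<in> \<omega> \<Longrightarrow> key a \<le> key b"
proof -
  obtain g :: "'a \<Rightarrow> nat" where g: "inj_on g A"
    using finite_imp_inj_to_nat_seg[OF assms] by blast
  define \<omega> where "\<omega> = {(a, b). a \<in> A \<and> b \<in> A \<and> (key a < key b \<or> key a = key b \<and> g a \<le> g b)}"
  have "linear_order_on A \<omega>"
    unfolding order_on_defs
  proof (intro conjI)
    show "\<omega> \<subseteq> A \<times> A" "refl_on A \<omega>" "trans \<omega>" "total_on A \<omega>"
      by (auto simp: \<omega>_def refl_on_def trans_def total_on_def)
    show "antisym \<omega>"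
      using g by (auto simp: \<omega>_def antisym_def inj_on_def)
  qed
  then show thesis
    using that by (force simp: \<omega>_def)
qed

section \<open>From adjoints to the two inclusions\<close>

context adjoint_candidate
begin

text \<open>All members of \<open>S\<close> avoid the intersection of their complements, so
  \<open>S\<close> is an independent subset of a set whose rank in \<open>N\<close> is the required
  bound.\<close>

lemma adjoint_imp_indep_in_S_family:
  assumes "adjoint M N"
  shows "indeps N \<subseteq> S_family M"
proof
  fix S
  assume S: "S \<in> indeps N"
  then have sub: "S \<subseteq> circuits M"
    using N.indeps_subset ground_N by blast
  let ?F = "ground M \<inter> (\<Inter>C\<in>S. ground M - C)"
  have "(\<lambda>C. ground M - C) ` S \<subseteq> flats (dual_matroid M)"
    using circuit_compl_flat sub by blast
  then have "?F \<in> flats (dual_matroid M)"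
    using D.Inter_flat by (simp only: ground_dual)
  then have "matroid_rank N (avoiding M ?F) = opp_rank M ?F"
    using assms adjoint_iff_avoiding by blast
  moreover have "S \<subseteq> avoiding M ?F"
    using sub unfolding avoiding_def by blast
  ultimately have "card S \<le> opp_rank M ?F"
    using N.card_le_rank[OF S, of "avoiding M ?F"] by (simp only:)
  with sub show "S \<in> S_family M"
    unfolding S_family_def by blast
qed

lemma adjoint_imp_NBB_indep:
  assumes "adjoint M N"
  shows "opp_NBB_family M \<subseteq> indeps N"
proof
  fix S
  assume "S \<in> opp_NBB_family M"
  then obtain \<omega> where sub: "S \<subseteq> circuits M"
    and \<omega>: "linear_order_on (hyperplanes (dual_matroid M)) \<omega>"
    and nbb: "NBB (opp_lattice M) \<omega> ((\<lambda>C. ground M - C) ` S)"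
    by (auto simp: opp_NBB_family_def NBB_family_def lattice_atoms_opp)
  show "S \<in> indeps N"
  proof (rule ccontr)
    assume "S \<notin> indeps N"
    then obtain X where X: "X \<in> circuits N" "X \<subseteq> S"
      by (rule N.obtain_circuit[rotated]) (simp_all add: sub ground_N)
    have "X \<noteq> {}"
      using X N.empty_indep by (auto simp only: circuits_def)
    then have ne: "(\<lambda>C. ground M - C) ` X \<noteq> {}"
      by simp
    have "finite X"
      using subset_trans[OF X(2) sub] N.finite_ground finite_subset unfolding ground_N by blast
    then have fin: "finite ((\<lambda>C. ground M - C) ` X)"
      by (rule finite_imageI)
    have hyp: "(\<lambda>C. ground M - C) ` X \<subseteq> hyperplanes (dual_matroid M)"
      using X sub by (auto intro: circuit_compl_hyperplane)
    obtain H where H: "H \<in> (\<lambda>C. ground M - C) ` X"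
      "\<forall>K\<in>(\<lambda>C. ground M - C) ` X. (H, K) \<in> \<omega>"
      using finite_linear_order_min[OF \<omega> fin ne hyp] by (rule bexE)
    then obtain c where c: "c \<in> X" "H = ground M - c"
      by blast
    let ?D = "(\<lambda>C. ground M - C) ` (X - {c})"
    let ?F = "ground M \<inter> \<Inter>?D"
    have D: "?D \<subseteq> flats (dual_matroid M)"
      using X sub circuit_compl_flat by blast
    then have F: "?F \<in> flats (dual_matroid M)"
      using D.Inter_flat[of ?D] by simp
    have "X - {c} \<subseteq> avoiding M ?F"
      using X sub unfolding avoiding_def by blast
    \<comment> \<open>\<open>avoiding M ?F\<close> is a flat of \<open>N\<close> containing
      \<open>X - {c}\<close>, hence also \<open>c\<close>, as \<open>X\<close> is a circuit of
      \<open>N\<close>.\<close>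
    then have "c \<in> avoiding M ?F"
      using N.circuit_closure[OF X(1) c(1)] N.closure_subset_flat[of "avoiding M ?F" "X - {c}"]
        assms F adjoint_iff_avoiding by blast
    then have c_disj: "c \<in> circuits M" "c \<inter> ?F = {}"
      by (auto simp: avoiding_def)
    then have c_ne: "c \<noteq> {}" "c \<subseteq> ground M"
      using circuit_nonempty circuit_subset by auto
    have "bounded_below (opp_lattice M) \<omega> ?D"
      unfolding bounded_below_def lattice_atoms_opp Sup_opp[OF D] opp_lattice_simps
    proof (intro conjI bexI[of _ H] ballI)
      \<comment> \<open>If \<open>?D\<close> were empty, \<open>?F\<close> would be the whole ground
        set, which no circuit avoids.\<close>
      show "?D \<noteq> {}"
        using c_disj c_ne by auto
      show "?D \<subseteq> hyperplanes (dual_matroid M)" "H \<in> hyperplanes (dual_matroid M)"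
        using hyp H by auto
      show "?F \<subseteq> H"
        using c_disj c by auto
      fix K
      assume K: "K \<in> ?D"
      then show "(H, K) \<in> \<omega>"
        using H(2) by auto
      obtain C where C: "C \<in> X" "C \<noteq> c" "K = ground M - C"
        using K by auto
      then have "C \<subseteq> ground M"
        using X sub circuit_subset by blast
      then show "H \<noteq> K"
        using C c c_ne by auto
    qed
    moreover have "?D \<subseteq> (\<lambda>C. ground M - C) ` S"
      using X by auto
    ultimately show False
      using nbb by (auto simp: NBB_def)
  qed
qed

section \<open>From adjoints to hyperplanes\<close>

lemma nonloop_rank:
  assumes "i \<in> ground M" "i \<notin> coloops M"
  shows "matroid_rank (dual_matroid M) {i} = 1" "{i} \<in> indeps (dual_matroid M)"
  using assms D.rank_indep[of "{i}"] by (auto simp: coloops_def loops_def)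

lemma avoiding_singleton: "avoiding M {i} = {C \<in> circuits M. i \<notin> C}"
  by (auto simp: avoiding_def)

text \<open>The point \<open>{i}\<close> need not be a flat of the dual, but its closure is one of
  rank 1 with the same avoiding circuits.\<close>

lemma adjoint_imp_hyperplane:
  assumes "adjoint M N" "i \<in> ground M" "i \<notin> coloops M"
  shows "avoiding M {i} \<in> hyperplanes N"
proof -
  let ?F = "matroid_closure (dual_matroid M) {i}"
  have sub: "{i} \<subseteq> ground (dual_matroid M)"
    using assms by simp
  have av: "avoiding M {i} = avoiding M ?F"
    using avoiding_closure[of "{i}"] assms by simp
  have "avoiding M ?F \<in> flats N" "matroid_rank N (avoiding M ?F) = opp_rank M ?F"
    using assms(1) D.closure_flat[OF sub] adjoint_iff_avoiding by blast+
  moreover have "matroid_rank (dual_matroid M) ?F = 1"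
    using D.rank_closure[OF sub] nonloop_rank assms by simp
  \<comment> \<open>This keeps the subtraction in \<open>opp_rank\<close> from being truncated, so
    that the corank is exactly 1.\<close>
  moreover have "1 \<le> matroid_rank (dual_matroid M) (ground M)"
    using D.rank_mono[OF sub] nonloop_rank assms by simp
  ultimately show ?thesis
    by (simp add: hyperplanes_def av ground_N rank_N_eq opp_rank_eq)
qed

section \<open>From hyperplanes to adjoints\<close>

lemma hyperplanes_imp_adjoint:
  assumes hyp: "\<And>i. i \<in> ground M \<Longrightarrow> i \<notin> coloops M \<Longrightarrow> avoiding M {i} \<in> hyperplanes N"
  shows "adjoint M N"
proof -
  let ?r = "matroid_rank (dual_matroid M)"
  let ?m = "?r (ground M)"
  let ?g = "\<lambda>F. matroid_rank N (avoiding M F)"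
  have flat: "avoiding M F \<in> flats N" if F: "F \<in> flats (dual_matroid M)" for F
  proof -
    have "avoiding M F = ground N \<inter> (\<Inter>i\<in>F - coloops M. avoiding M {i})"
    proof -
      have "i \<notin> C" if "i \<in> coloops M" "C \<in> circuits M" for i C
        using D.loop_in_flat[OF circuit_compl_flat[OF that(2)]] that(1) by (auto simp: coloops_def)
      then show ?thesis
        by (auto simp: avoiding_def ground_N)
    qed
    moreover have "(\<lambda>i. avoiding M {i}) ` (F - coloops M) \<subseteq> flats N"
      using hyp D.flat_subset[OF F] by (auto simp: hyperplanes_def)
    ultimately show ?thesis
      using N.Inter_flat by simp
  qed
  have strict: "?g G < ?g F"
    if F: "F \<in> flats (dual_matroid M)" and G: "G \<in> flats (dual_matroid M)" and "F \<subset> G" for F G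
  proof (rule N.flat_rank_strict[OF flat[OF G]])
    show "avoiding M G \<subset> avoiding M F"
      using avoiding_subset_iff[OF F, of G] D.flat_subset[OF G] \<open>F \<subset> G\<close> avoiding_antimono[of F G]
      by auto
    show "avoiding M F \<subseteq> ground N"
      by (auto simp: avoiding_def ground_N)
  qed
  \<comment> \<open>Descend from \<open>F\<close> to rank 0: each cover step lowers
    \<open>?r\<close> by 1 and raises \<open>?g\<close> by at least 1, while \<open>?g\<close> never
    exceeds the rank \<open>?m\<close> of \<open>N\<close>.\<close>
  have upper: "?g F + ?r F \<le> ?m" if "F \<in> flats (dual_matroid M)" for F
    using that
  proof (induction "?r F" arbitrary: F)
    case 0
    have "?g F \<le> matroid_rank N (ground N)"
      by (rule N.rank_mono) (auto simp: avoiding_def ground_N)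
    with 0 show ?case
      by (simp add: ground_N rank_N_eq)
  next
    case (Suc k)
    have pos: "0 < ?r F"
      using Suc.hyps(2) by simp
    obtain G where G: "G \<in> flats (dual_matroid M)" "G \<subset> F" "Suc (?r G) = ?r F"
      by (rule D.flat_cover_below[OF Suc.prems pos])
    then have "k = ?r G"
      using Suc.hyps(2) by simp
    then show ?case
      using Suc.hyps(1)[OF _ G(1)] strict[OF G(1) Suc.prems G(2)] G(3) by simp
  qed
  \<comment> \<open>Climb from \<open>F\<close> to full rank: each cover step raises
    \<open>?r\<close> by 1 and lowers \<open>?g\<close> by at least 1, and at the top the bound is
    trivial.\<close>
  have lower: "?m \<le> ?g F + ?r F" if "F \<in> flats (dual_matroid M)" for F
    using that
  proof (induction "?m - ?r F" arbitrary: F)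
    case 0
    then show ?case
      by simp
  next
    case (Suc k)
    then have ne: "F \<noteq> ground (dual_matroid M)"
      by auto
    obtain G where G: "G \<in> flats (dual_matroid M)" "F \<subset> G" "?r G = Suc (?r F)"
      by (rule D.flat_cover_above[OF Suc.prems ne])
    then have "k = ?m - ?r G"
      using Suc.hyps(2) by simp
    then show ?case
      using Suc.hyps(1)[OF _ G(1)] strict[OF Suc.prems G(1,2)] G(3) by simp
  qed
  have "?g F = opp_rank M F" if "F \<in> flats (dual_matroid M)" for F
    using upper[OF that] lower[OF that] by (simp add: opp_rank_eq)
  with flat show ?thesis
    by (simp add: adjoint_iff_avoiding)
qed

section \<open>From the two inclusions to hyperplanes\<close>

text \<open>The atoms \<open>W b\<close> come from a maximal chain of flats spanned by initial segments of \<open>B\<close>,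
  enumerated with \<open>i\<close> first. Ordering all atoms by the first element of \<open>B\<close> that they miss,
  with \<open>W b\<close> put first among those that miss \<open>b\<close>, makes the \<open>W b\<close> an NBB set.\<close>

lemma NBB_of_basis:
  assumes B: "B \<in> indeps (dual_matroid M)" "card B = matroid_rank (dual_matroid M) (ground M)"
    and i: "i \<in> B" and H: "H \<in> hyperplanes (dual_matroid M)" "i \<notin> H"
  defines "W \<equiv> \<lambda>b. if b = i then H else matroid_closure (dual_matroid M) (B - {b})"
  shows "inj_on W B" "W ` B \<in> NBB_family (opp_lattice M)"
proof -
  let ?Hyp = "hyperplanes (dual_matroid M)"
  have finB: "finite B"
    by (rule D.finite_indep[OF B(1)])
  have BE: "B \<subseteq> ground M"
    using D.indeps_subset[OF B(1)] by simp
  have B': "card B = matroid_rank (dual_matroid M) (ground (dual_matroid M))"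
    using B by simp
  \<comment> \<open>\<open>k\<close> enumerates \<open>B\<close> with \<open>i\<close> strictly
    first; the shift by \<open>Suc\<close> reserves index 0 for \<open>i\<close>.\<close>
  obtain k :: "'a \<Rightarrow> nat" where k: "inj_on k B" "k i = 0"
  proof -
    obtain k0 :: "'a \<Rightarrow> nat" where "inj_on k0 B"
      using finite_imp_inj_to_nat_seg[OF finB] by blast
    then have "inj_on (\<lambda>x. if x = i then 0 else Suc (k0 x)) B"
      by (auto simp: inj_on_def)
    then show thesis
      by (rule that) simp
  qed
  \<comment> \<open>The minimum is meaningful on hyperplanes, as none of them contains the basis
    \<open>B\<close>.\<close>
  define t where "t K = Min (k ` (B - K))" for K
  have Whyp: "W b \<in> ?Hyp" if "b \<in> B" for b
    using D.basis_minus_hyperplane(1)[OF B(1) B' that] H by (auto simp: W_def)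
  have W_notin: "b \<notin> W b" if "b \<in> B" for b
    using D.basis_minus_hyperplane(2)[OF B(1) B' that] H by (auto simp: W_def)
  \<comment> \<open>The case \<open>b = i\<close> is excluded because \<open>H\<close> may miss
    further elements of \<open>B\<close>; index 0 for \<open>i\<close> makes \<open>t (W i)\<close>
    right all the same.\<close>
  have W_in: "x \<in> W b" if "x \<in> B" "x \<noteq> b" "b \<noteq> i" for x b
    using that D.subset_closure[of "B - {b}"] BE by (auto simp: W_def)
  have t_W: "t (W b) = k b" if b: "b \<in> B" for b
  proof (cases "b = i")
    case True
    have "t (W i) \<le> k i"
      unfolding t_def using finB i W_notin[OF i] by (intro Min_le) auto
    then show ?thesis
      using True k(2) by simp
  next
    case False
    then have "B - W b = {b}"
      using W_in W_notin[OF b] b by auto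
    then show ?thesis
      by (simp add: t_def)
  qed
  show inj: "inj_on W B"
    using t_W k(1) unfolding inj_on_def by metis
  have finHyp: "finite ?Hyp"
    by (rule finite_subset[of _ "Pow (ground M)"])
      (use finite_ground D.flat_subset in \<open>auto simp: hyperplanes_def\<close>)
  define key where "key K = 2 * t K + (if K \<in> W ` B then 0 else 1)" for K
  obtain \<omega> where \<omega>: "linear_order_on ?Hyp \<omega>" "\<And>a b. (a, b) \<in> \<omega> \<Longrightarrow> key a \<le> key b"
    using linear_order_on_of_key[OF finHyp, of key] by blast
  have "\<not> bounded_below (opp_lattice M) \<omega> D" if D: "D \<subseteq> W ` B" for D
  proof
    assume bb: "bounded_below (opp_lattice M) \<omega> D"
    have "D \<subseteq> flats (dual_matroid M)"
      using D Whyp by (auto simp: hyperplanes_def)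
    then obtain a where a: "a \<in> ?Hyp" "\<And>d. d \<in> D \<Longrightarrow> (a, d) \<in> \<omega> \<and> a \<noteq> d"
        "ground M \<inter> \<Inter>D \<subseteq> a" and ne: "D \<noteq> {}"
      using bb by (auto simp: bounded_below_def lattice_atoms_opp Sup_opp)
    obtain B0 where B0: "B0 \<subseteq> B" "D = W ` B0"
      using D by (meson subset_imageE)
    obtain b where b: "b \<in> B0" "\<And>c. c \<in> B0 \<Longrightarrow> k b \<le> k c"
      using ne B0 ex_has_least_nat[of "\<lambda>b. b \<in> B0" _ k] by blast
    \<comment> \<open>An \<open>x\<close> of smaller index than all of \<open>B0\<close> lies in
      every \<open>W c\<close> with \<open>c\<close> in \<open>B0\<close>, hence in
      \<open>a\<close>. Here \<open>c\<close> differs from \<open>i\<close> since its index exceeds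
      that of \<open>x\<close>.\<close>
    have "k b \<le> k x" if x: "x \<in> B - a" for x
    proof (rule ccontr)
      assume less: "\<not> k b \<le> k x"
      have "x \<in> W c" if c: "c \<in> B0" for c
      proof (rule W_in)
        show "x \<in> B" "x \<noteq> c" "c \<noteq> i"
          using x less b(2)[OF c] k(2) by auto
      qed
      then have "x \<in> a"
        using a(3) B0 x BE by blast
      with x show False
        by simp
    qed
    moreover have "B - a \<noteq> {}"
    proof
      assume "B - a = {}"
      then have "card B \<le> matroid_rank (dual_matroid M) a"
        by (intro D.card_le_rank[OF B(1)]) auto
      then show False
        using a(1) B(2) by (simp add: hyperplanes_def)
    qed
    ultimately have "k b \<le> t a"
      unfolding t_def using finB by (intro Min.boundedI) auto
    \<comment> \<open>\<open>a\<close> precedes \<open>W b\<close>, whose key is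
      \<open>2 * k b\<close>. With \<open>k b \<le> t a\<close> this leaves only
      \<open>a = W b\<close>, but \<open>a\<close> was to differ from every member of
      \<open>D\<close>.\<close>
    moreover have "key a \<le> 2 * k b"
      using \<omega>(2)[of a "W b"] a(2)[of "W b"] b(1) B0 t_W[of b] by (auto simp: key_def)
    ultimately have "t a = k b" "a \<in> W ` B"
      by (auto simp: key_def split: if_splits)
    then obtain c where "c \<in> B" "a = W c" "k c = k b"
      using t_W by auto
    then have "a = W b"
      using k(1) b(1) B0 by (auto simp: inj_on_def)
    then show False
      using a(2) b(1) B0 by auto
  qed
  then have "NBB (opp_lattice M) \<omega> (W ` B)"
    using Whyp by (auto simp: NBB_def lattice_atoms_opp)
  then show "W ` B \<in> NBB_family (opp_lattice M)"
    using \<omega>(1) by (auto simp: NBB_family_def lattice_atoms_opp)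
qed

lemma NBB_S_family_imp_hyperplane:
  assumes lower: "opp_NBB_family M \<subseteq> indeps N" and upper: "indeps N \<subseteq> S_family M"
    and i: "i \<in> ground M" "i \<notin> coloops M"
  shows "avoiding M {i} \<in> hyperplanes N"
  unfolding N.hyperplane_iff_maximal_nonspanning ground_N rank_N_eq
proof (intro conjI allI impI notI)
  show "avoiding M {i} \<subseteq> circuits M"
    by (auto simp: avoiding_def)
next
  let ?r = "matroid_rank (dual_matroid M)"
  assume eq: "matroid_rank N (avoiding M {i}) = ?r (ground M)"
  obtain Y where Y: "Y \<in> indeps N" "Y \<subseteq> avoiding M {i}" "card Y = matroid_rank N (avoiding M {i})"
    by (rule N.obtain_basis)
  let ?F = "ground M \<inter> (\<Inter>C\<in>Y. ground M - C)"
  have "card Y \<le> opp_rank M ?F"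
    using Y(1) upper unfolding S_family_def by blast
  \<comment> \<open>All circuits in \<open>Y\<close> miss \<open>i\<close>, so \<open>?F\<close>
    contains a nonloop of the dual and its \<open>opp_rank\<close> is below the full rank, too small
    for \<open>Y\<close>.\<close>
  moreover have "{i} \<subseteq> ?F"
    using Y(2) i by (auto simp: avoiding_def)
  then have "1 \<le> ?r ?F"
    using D.rank_mono[of "{i}" ?F] nonloop_rank[OF i] by simp
  moreover have "?r ?F \<le> ?r (ground M)"
    by (rule D.rank_mono) auto
  ultimately show False
    using eq Y(3) by (simp add: opp_rank_eq)
next
  let ?compl = "\<lambda>C. ground M - C"
  fix X
  assume X: "X \<subseteq> circuits M" "avoiding M {i} \<subset> X"
  then obtain C where C: "C \<in> X" "C \<in> circuits M" "i \<in> C"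
    by (auto simp: avoiding_def)
  obtain B where B: "B \<in> indeps (dual_matroid M)" "{i} \<subseteq> B" "B \<subseteq> ground M"
    "card B = matroid_rank (dual_matroid M) (ground M)"
    by (rule D.extend_to_basis[OF nonloop_rank(2)[OF i], of "ground M"]) (use i in auto)
  \<comment> \<open>Only \<open>W i\<close> misses \<open>i\<close>, and its circuit is
    \<open>C\<close>, already in \<open>X\<close>; the circuits of the other \<open>W b\<close>
    avoid \<open>i\<close>. So \<open>X\<close> contains an NBB set of full size.\<close>
  define W where "W b = (if b = i then ?compl C else matroid_closure (dual_matroid M) (B - {b}))" for b
  have iB: "i \<in> B" and iC: "i \<notin> ?compl C"
    using B(2) C(3) by auto
  note NBB = NBB_of_basis[OF B(1,4) iB circuit_compl_hyperplane[OF C(2)] iC, folded W_def]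
  have Wsub: "W b \<subseteq> ground M" for b
    using D.closure_subset_ground by (auto simp: W_def)
  have W_hyp: "W b \<in> hyperplanes (dual_matroid M)" if "b \<in> B" for b
    using D.basis_minus_hyperplane(1)[OF B(1) _ that] B(4) circuit_compl_hyperplane[OF C(2)]
    by (auto simp: W_def)
  have circ: "?compl (W b) \<in> circuits M" if "b \<in> B" for b
    using circuit_iff_hyperplane_dual[of "?compl (W b)"] W_hyp[OF that] Wsub
    by (simp add: double_diff)
  let ?S = "(\<lambda>b. ?compl (W b)) ` B"
  have "?compl ` ?S = W ` B"
    using Wsub by (simp add: image_image double_diff)
  then have "?S \<in> opp_NBB_family M"
    using NBB(2) circ by (auto simp: opp_NBB_family_def)
  then have ind: "?S \<in> indeps N"
    using lower by blast
  have "inj_on (\<lambda>b. ?compl (W b)) B"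
    using NBB(1) Wsub unfolding inj_on_def by (metis double_diff order_refl)
  then have card: "card ?S = matroid_rank (dual_matroid M) (ground M)"
    using B(4) by (simp add: card_image)
  have "?S \<subseteq> X"
  proof
    fix C'
    assume "C' \<in> ?S"
    then obtain b where b: "b \<in> B" "C' = ?compl (W b)"
      by blast
    show "C' \<in> X"
    proof (cases "b = i")
      case True
      then show ?thesis
        using b C circuit_subset by (simp add: W_def double_diff)
    next
      case False
      then have "i \<in> W b"
        using D.subset_closure[of "B - {b}"] B(3) iB by (auto simp: W_def)
      then have "C' \<in> avoiding M {i}"
        using circ[OF b(1)] b(2) by (auto simp: avoiding_def)
      then show ?thesis
        using X(2) by blast
    qed
  qed
  then have "matroid_rank (dual_matroid M) (ground M) \<le> matroid_rank N X"
    using N.card_le_rank[OF ind] card by simp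
  then show "matroid_rank N X = matroid_rank (dual_matroid M) (ground M)"
    using N.rank_mono[OF X(1)] rank_N_eq by simp
qed

end

theorem theorem5p1:
  fixes M :: "nat matroid" and N :: "nat set matroid" and n d :: nat
  assumes "matroid M" and "ground M = {1..n}" and "matroid_rank M (ground M) = d"
    and "matroid N" and "ground N = circuits M" and "matroid_rank N (ground N) = n - d"
  shows "(adjoint M N \<longleftrightarrow>
            opp_NBB_family M \<subseteq> indeps N \<and> indeps N \<subseteq> S_family M)
       \<and> (adjoint M N \<longleftrightarrow>
            (\<forall>i\<in>{1..n}. i \<notin> coloops M \<longrightarrow> {C \<in> circuits M. i \<notin> C} \<in> hyperplanes N))"
proof -
  interpret adjoint_candidate M N
    using assms by (simp add: adjoint_candidate_def adjoint_candidate_axioms_def)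
  \<comment> \<open>The cycle (1), (2), (3), (1) of implications, together with the direct step from
    (1) to (3), gives both equivalences.\<close>
  show ?thesis
    unfolding assms(2)[symmetric] avoiding_singleton[symmetric]
    using adjoint_imp_NBB_indep adjoint_imp_indep_in_S_family adjoint_imp_hyperplane
      hyperplanes_imp_adjoint NBB_S_family_imp_hyperplane by metis
qed

end
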